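(* Let $\Gamma=\{(e^{-t}\cos t,\ e^{-t}\sin t): t\ge 0\}\subset\mathbb R^2$ and let $\Lambda=\{(e^{s}\cos s,\ e^{s}\sin s): s\le 0\}\subset\mathbb R^2$. Then $(\Gamma,\Lambda)$ is a Heisenberg uniqueness pair.
   Context: For a curve $\Gamma\subset\mathbb R^2$ (a finite disjoint union of smooth curves), $X(\Gamma)$ denotes the space of all finite complex-valued Borel measures $\mu$ on $\mathbb R^2$ that are supported on $\Gamma$ and absolutely continuous with respect to the arc length measure on $\Gamma$. The Fourier transform of $\mu$ is $\hat\mu(\xi,\eta)=\int_\Gamma e^{-i\pi(x\xi+y\eta)}\,d\mu(x,y)$ for $(\xi,\eta)\in\mathbb R^2$. For a set $\Lambda\subset\mathbb R^2$, the pair $(\Gamma,\Lambda)$ is a Heisenberg uniqueness pair (HUP) if every $\mu\in X(\Gamma)$ with $\hat\mu(\xi,\eta)=0$ for all $(\xi,\eta)\in\Lambda$ satisfies $\mu=0$. *)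

theory Defs
  imports "HOL-Analysis.Analysis"
begin

text \<open>
  Finite complex Borel measures are complex-valued set functions; only their values on Borel
  sets are relevant. Additivity applied to the constant sequence of empty sets gives the value 0
  at the empty set.
\<close>

definition complex_borel_measure :: "('a::topological_space set \<Rightarrow> complex) \<Rightarrow> bool" where
  "complex_borel_measure \<mu> \<longleftrightarrow>
     (\<forall>A :: nat \<Rightarrow> 'a set. range A \<subseteq> sets borel \<longrightarrow> disjoint_family A \<longrightarrow>
        (\<lambda>i. \<mu> (A i)) sums \<mu> (\<Union>i. A i))"

text \<open>
  The positive part of the Jordan decomposition of a finite signed Borel measure \<open>\<nu>\<close>:
  \<open>\<nu>\<^sup>+(A) = sup {\<nu>(B) | B \<subseteq> A Borel}\<close>. The coercion \<^const>\<open>ennreal\<close> sends negative values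
  to 0, which does not change the supremum since \<open>\<nu> {} = 0\<close>.
  The negative part is \<open>(-\<nu>)\<^sup>+\<close>.
\<close>

definition positive_variation :: "('a::topological_space set \<Rightarrow> real) \<Rightarrow> 'a measure" where
  "positive_variation \<nu> =
     measure_of UNIV (sets borel) (\<lambda>A. SUP B\<in>{B \<in> sets borel. B \<subseteq> A}. ennreal (\<nu> B))"

definition signed_integral :: "('a::topological_space set \<Rightarrow> real) \<Rightarrow> ('a \<Rightarrow> complex) \<Rightarrow> complex" where
  "signed_integral \<nu> f =
     (\<integral>x. f x \<partial>positive_variation \<nu>) - (\<integral>x. f x \<partial>positive_variation (\<lambda>A. - \<nu> A))"

definition complex_measure_integral ::
    "('a::topological_space set \<Rightarrow> complex) \<Rightarrow> ('a \<Rightarrow> complex) \<Rightarrow> complex" where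
  "complex_measure_integral \<mu> f =
     signed_integral (\<lambda>A. Re (\<mu> A)) f + \<i> * signed_integral (\<lambda>A. Im (\<mu> A)) f"

text \<open>
  \<open>C\<^sup>\<infinity>\<close> regular injective parametrization on a nondegenerate interval, with one-sided derivatives
  at endpoints belonging to the interval; \<open>D n\<close> is the \<open>n\<close>-th derivative. A simple closed curve
  is parametrized on a half-open interval.
\<close>

definition smooth_parametrization :: "(real \<Rightarrow> real \<times> real) \<Rightarrow> real set \<Rightarrow> bool" where
  "smooth_parametrization \<gamma> I \<longleftrightarrow>
     is_interval I \<and> interior I \<noteq> {} \<and> inj_on \<gamma> I \<and>
     (\<exists>D :: nat \<Rightarrow> real \<Rightarrow> real \<times> real.
        D 0 = \<gamma> \<and>
        (\<forall>n. \<forall>t\<in>I. (D n has_vector_derivative D (Suc n) t) (at t within I)) \<and>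
        (\<forall>t\<in>I. D 1 t \<noteq> 0))"

definition arc_length_measure :: "(real \<Rightarrow> real \<times> real) \<Rightarrow> real set \<Rightarrow> (real \<times> real) measure" where
  "arc_length_measure \<gamma> I =
     distr (density (restrict_space lborel I)
              (\<lambda>t. ennreal (norm (vector_derivative \<gamma> (at t within I)))))
           borel \<gamma>"

text \<open>
  \<open>\<Gamma>\<close> is a finite disjoint union of smooth curves and \<open>\<sigma>\<close> is its arc length measure,
  regarded as a Borel measure on the plane that vanishes off \<open>\<Gamma>\<close>.
  The measure does not depend on the chosen parametrizations.
\<close>

definition curve_arc_length :: "(real \<times> real) set \<Rightarrow> (real \<times> real) measure \<Rightarrow> bool" where
  "curve_arc_length \<Gamma> \<sigma> \<longleftrightarrow>
     (\<exists>(m::nat) \<gamma> I.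
        (\<forall>j<m. smooth_parametrization (\<gamma> j) (I j)) \<and>
        disjoint_family_on (\<lambda>j. \<gamma> j ` I j) {..<m} \<and>
        \<Gamma> = (\<Union>j<m. \<gamma> j ` I j) \<and>
        sets \<sigma> = sets borel \<and>
        (\<forall>A\<in>sets borel. emeasure \<sigma> A = (\<Sum>j<m. emeasure (arc_length_measure (\<gamma> j) (I j)) A)))"

definition smooth_curve :: "(real \<times> real) set \<Rightarrow> bool" where
  "smooth_curve \<Gamma> \<longleftrightarrow> (\<exists>\<sigma>. curve_arc_length \<Gamma> \<sigma>)"

definition curve_measures :: "(real \<times> real) set \<Rightarrow> ((real \<times> real) set \<Rightarrow> complex) set" where
  "curve_measures \<Gamma> =
     {\<mu>. complex_borel_measure \<mu> \<and>
         (\<forall>A\<in>sets borel. A \<inter> \<Gamma> = {} \<longrightarrow> \<mu> A = 0) \<and>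
         (\<exists>\<sigma>. curve_arc_length \<Gamma> \<sigma> \<and> (\<forall>A\<in>null_sets \<sigma>. \<mu> A = 0))}"

text \<open>
  The integral is written over the whole plane; for a measure supported on \<open>\<Gamma>\<close> it is the
  integral over \<open>\<Gamma>\<close>.
\<close>

definition fourier_transform :: "((real \<times> real) set \<Rightarrow> complex) \<Rightarrow> real \<times> real \<Rightarrow> complex" where
  "fourier_transform \<mu> = (\<lambda>(\<xi>, \<eta>).
     complex_measure_integral \<mu>
       (\<lambda>(x, y). exp (- \<i> * of_real pi * of_real (x * \<xi> + y * \<eta>))))"

definition heisenberg_uniqueness_pair :: "(real \<times> real) set \<Rightarrow> (real \<times> real) set \<Rightarrow> bool" where
  "heisenberg_uniqueness_pair \<Gamma> \<Lambda> \<longleftrightarrow>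
     smooth_curve \<Gamma> \<and>
     (\<forall>\<mu>\<in>curve_measures \<Gamma>.
        (\<forall>\<zeta>\<in>\<Lambda>. fourier_transform \<mu> \<zeta> = 0) \<longrightarrow> (\<forall>A\<in>sets borel. \<mu> A = 0))"

end

theory Submission
  imports Defs "HOL-Complex_Analysis.Cauchy_Integral_Formula"
begin

text \<open>
  For \<open>\<zeta> = e\<^sup>s (cos s, sin s)\<close> the transform is \<open>\<Sum>\<^sub>n (-\<i>\<pi>)\<^sup>n / n! e\<^sup>n\<^sup>s P\<^sub>n(s)\<close>, where
  \<open>P\<^sub>n(s) = \<integral> (x cos s + y sin s)\<^sup>n d\<mu>\<close> is \<open>2\<pi>\<close>-periodic. Along \<open>s - 2\<pi>k\<close> this is a power series
  vanishing at a null sequence, so every moment \<open>\<integral> (x \<bullet> v)\<^sup>n d\<mu>\<close> vanishes. By polarization \<open>\<mu>\<close>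
  annihilates all polynomials, and as it lives on a compact set, the Weierstrass theorem
  gives \<open>\<mu> = 0\<close>.
\<close>

section \<open>Jordan decomposition\<close>

locale signed_borel_measure =
  fixes \<nu> :: "'a::topological_space set \<Rightarrow> real"
  assumes sums_disjoint: "range A \<subseteq> sets borel \<Longrightarrow> disjoint_family A \<Longrightarrow> (\<lambda>i. \<nu> (A i)) sums \<nu> (\<Union>i. A i)"
begin

lemma uminus: "signed_borel_measure (\<lambda>A. - \<nu> A)"
  by unfold_locales (rule sums_minus, rule sums_disjoint)

lemma empty [simp]: "\<nu> {} = 0"
proof -
  have "(\<lambda>i::nat. \<nu> {}) sums \<nu> (\<Union>i::nat. {})"
    by (rule sums_disjoint) (auto simp: disjoint_family_on_def)
  then have "summable (\<lambda>i::nat. \<nu> {})"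
    by (rule sums_summable)
  then have "(\<lambda>i::nat. \<nu> {}) \<longlonglongrightarrow> 0"
    by (rule summable_LIMSEQ_zero)
  then show ?thesis
    by (simp add: LIMSEQ_const_iff)
qed

lemma Un_disjoint:
  assumes "A \<in> sets borel" "B \<in> sets borel" "A \<inter> B = {}"
  shows "\<nu> (A \<union> B) = \<nu> A + \<nu> B"
proof -
  have "(\<lambda>i. \<nu> (binaryset A B i)) sums \<nu> (\<Union>i. binaryset A B i)"
    using assms by (intro sums_disjoint) (auto simp: range_binaryset_eq disjoint_family_on_def binaryset_def)
  moreover have "(\<lambda>i. \<nu> (binaryset A B i)) sums (\<nu> A + \<nu> B)"
    by (rule binaryset_sums) simp
  ultimately show ?thesis
    by (simp add: UN_binaryset_eq sums_unique2)
qed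

lemma Diff:
  assumes "A \<in> sets borel" "B \<in> sets borel" "B \<subseteq> A"
  shows "\<nu> (A - B) = \<nu> A - \<nu> B"
  using Un_disjoint[of B "A - B"] assms by (simp add: Un_absorb1 Diff_partition)

section \<open>Boundedness of finite signed measures\<close>

definition bounded_on :: "'a set \<Rightarrow> bool" where
  "bounded_on A \<longleftrightarrow> (\<exists>c. \<forall>B\<in>sets borel. B \<subseteq> A \<longrightarrow> \<bar>\<nu> B\<bar> \<le> c)"

lemma bounded_on_Un:
  assumes "A \<in> sets borel" "B \<in> sets borel" "bounded_on A" "bounded_on B" "A \<inter> B = {}"
  shows "bounded_on (A \<union> B)"
proof -
  obtain a where a: "\<And>C. C \<in> sets borel \<Longrightarrow> C \<subseteq> A \<Longrightarrow> \<bar>\<nu> C\<bar> \<le> a"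
    using assms(3) unfolding bounded_on_def by blast
  obtain b where b: "\<And>C. C \<in> sets borel \<Longrightarrow> C \<subseteq> B \<Longrightarrow> \<bar>\<nu> C\<bar> \<le> b"
    using assms(4) unfolding bounded_on_def by blast
  have "\<bar>\<nu> C\<bar> \<le> a + b" if "C \<in> sets borel" "C \<subseteq> A \<union> B" for C
  proof -
    have "C = (C \<inter> A) \<union> (C \<inter> B)"
      using that by auto
    then have "\<nu> C = \<nu> (C \<inter> A) + \<nu> (C \<inter> B)"
      using Un_disjoint[of "C \<inter> A" "C \<inter> B"] assms that by auto
    then show ?thesis
      using a[of "C \<inter> A"] b[of "C \<inter> B"] assms that by auto
  qed
  then show ?thesis
    unfolding bounded_on_def by blast
qed

text \<open>Additivity and the margin \<open>1 + \<bar>\<nu> A\<bar>\<close> in the choice of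
  \<open>C\<close> give both \<open>C\<close> and \<open>A - C\<close> modulus at least 1. By
  \<open>bounded_on_Un\<close> at least one of them is again unbounded; that one is kept and the
  other is split off.\<close>

lemma split_unbounded:
  assumes A: "A \<in> sets borel" "\<not> bounded_on A"
  shows "\<exists>B\<in>sets borel. B \<subseteq> A \<and> \<not> bounded_on B \<and> \<bar>\<nu> (A - B)\<bar> \<ge> 1"
proof -
  obtain C where C: "C \<in> sets borel" "C \<subseteq> A" "\<bar>\<nu> C\<bar> > 1 + \<bar>\<nu> A\<bar>"
    using A unfolding bounded_on_def by (metis not_le)
  have D: "\<nu> (A - C) = \<nu> A - \<nu> C"
    using A C by (intro Diff)
  have eq: "A - (A - C) = C" "C \<union> (A - C) = A"
    using C by auto
  have "\<not> bounded_on C \<or> \<not> bounded_on (A - C)"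
    using bounded_on_Un[of C "A - C"] A C eq by auto
  then show ?thesis
  proof
    assume "\<not> bounded_on C"
    then show ?thesis
      using C D by (intro bexI[of _ C]) auto
  next
    assume "\<not> bounded_on (A - C)"
    then show ?thesis
      using C A eq by (intro bexI[of _ "A - C"]) auto
  qed
qed

text \<open>Otherwise iterating \<open>split_unbounded\<close> gives disjoint sets of values at least 1 in modulus,
  whose values form a convergent series.\<close>

lemma bounded_on_UNIV: "bounded_on UNIV"
proof (rule ccontr)
  assume unbdd: "\<not> bounded_on UNIV"
  let ?P = "\<lambda>(_::nat) A. A \<in> sets borel \<and> \<not> bounded_on A"
  let ?Q = "\<lambda>(_::nat) A B. B \<subseteq> A \<and> \<bar>\<nu> (A - B)\<bar> \<ge> 1"
  have "\<exists>A. \<forall>n. ?P n (A n) \<and> ?Q n (A n) (A (Suc n))"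
  proof (rule dependent_nat_choice)
    show "\<exists>A. ?P 0 A"
      using unbdd by (intro exI[of _ UNIV]) auto
    show "\<exists>B. ?P (Suc n) B \<and> ?Q n A B" if "?P n A" for A n
      using split_unbounded[of A] that by blast
  qed
  then obtain A where A: "\<And>n. A n \<in> sets borel" "\<And>n. A (Suc n) \<subseteq> A n"
      "\<And>n. \<bar>\<nu> (A n - A (Suc n))\<bar> \<ge> 1"
    by blast
  have anti: "A n \<subseteq> A m" if "m \<le> n" for m n
    using lift_Suc_antimono_le[of A m n] A(2) that by blast
  have disj: "(A m - A (Suc m)) \<inter> (A n - A (Suc n)) = {}" if "m < n" for m n
    using anti[of "Suc m" n] that by auto
  have "disjoint_family (\<lambda>n. A n - A (Suc n))"
    unfolding disjoint_family_on_def by (metis disj inf_commute linorder_neqE_nat)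
  then have "summable (\<lambda>n. \<nu> (A n - A (Suc n)))"
    using A(1) by (intro sums_summable[OF sums_disjoint]) auto
  then have "(\<lambda>n. \<nu> (A n - A (Suc n))) \<longlonglongrightarrow> 0"
    by (rule summable_LIMSEQ_zero)
  from LIMSEQ_D[OF this zero_less_one] obtain n where "norm (\<nu> (A n - A (Suc n)) - 0) < 1"
    by blast
  then show False
    using A(3)[of n] by simp
qed

section \<open>The positive variation as a finite measure\<close>

definition pv :: "'a set \<Rightarrow> ennreal" where
  "pv A = (SUP B\<in>{B \<in> sets borel. B \<subseteq> A}. ennreal (\<nu> B))"

lemma pv_upper: "B \<in> sets borel \<Longrightarrow> B \<subseteq> A \<Longrightarrow> ennreal (\<nu> B) \<le> pv A"
  unfolding pv_def by (intro SUP_upper) auto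

lemma pv_least: "(\<And>B. B \<in> sets borel \<Longrightarrow> B \<subseteq> A \<Longrightarrow> ennreal (\<nu> B) \<le> c) \<Longrightarrow> pv A \<le> c"
  unfolding pv_def by (intro SUP_least) auto

lemma pv_mono: "A \<subseteq> B \<Longrightarrow> pv A \<le> pv B"
  by (intro pv_least pv_upper) auto

text \<open>For \<open>C\<close> inside \<open>A\<close> and \<open>D\<close> inside
  \<open>B\<close> the value of \<open>C \<union> D\<close> is the sum of the two values; the
  suprema over \<open>D\<close> and then over \<open>C\<close> are taken afterwards.\<close>

lemma pv_Un_ge:
  assumes "A \<in> sets borel" "B \<in> sets borel" "A \<inter> B = {}"
  shows "pv A + pv B \<le> pv (A \<union> B)"
proof -
  have "ennreal (\<nu> C) + ennreal (\<nu> D) \<le> pv (A \<union> B)"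
    if "C \<in> sets borel" "C \<subseteq> A" "D \<in> sets borel" "D \<subseteq> B" for C D
  proof -
    have *: "\<nu> (C \<union> D) = \<nu> C + \<nu> D"
      using that assms by (intro Un_disjoint) auto
    \<comment> \<open>\<open>ennreal\<close> is additive only on nonnegative reals. A set of
      nonpositive value is truncated to 0, and then the other set alone is the competitor.\<close>
    consider "\<nu> C \<le> 0" | "\<nu> D \<le> 0" | "\<nu> C \<ge> 0" "\<nu> D \<ge> 0"
      by linarith
    then show ?thesis
    proof cases
      case 1
      then show ?thesis
        using pv_upper[of D "A \<union> B"] that by (simp add: ennreal_neg le_supI2)
    next
      case 2
      then show ?thesis
        using pv_upper[of C "A \<union> B"] that by (simp add: ennreal_neg le_supI1)
    next
      case 3
      then show ?thesis
        using pv_upper[of "C \<union> D" "A \<union> B"] that * by (auto simp flip: ennreal_plus)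
    qed
  qed
  note le = this
  have ne: "{B \<in> sets borel. B \<subseteq> C} \<noteq> {}" for C :: "'a set"
    by blast
  have "ennreal (\<nu> C) + pv B \<le> pv (A \<union> B)" if "C \<in> sets borel" "C \<subseteq> A" for C
    unfolding pv_def[of B] ennreal_SUP_add_right[OF ne] using that le by (intro SUP_least) blast
  then show ?thesis
    unfolding pv_def[of A] ennreal_SUP_add_left[OF ne, symmetric] by (intro SUP_least) blast
qed

text \<open>One inequality is finite superadditivity followed by monotonicity; for the other, a
  Borel subset \<open>B\<close> of the union is cut into the pieces
  \<open>B \<inter> A i\<close>.\<close>

lemma pv_UN:
  assumes A: "range A \<subseteq> sets borel" "disjoint_family A"
  shows "(\<Sum>i. pv (A i)) = pv (\<Union>i. A i)"
proof (rule antisym)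
  have meas: "A i \<in> sets borel" for i
    using A(1) by blast
  have "(\<Sum>i<n. pv (A i)) \<le> pv (\<Union>i<n. A i)" for n
  proof (induction n)
    case (Suc n)
    have "A n \<inter> A i = {}" if "i < n" for i
      using that by (intro disjoint_family_onD[OF A(2)]) auto
    then have "A n \<inter> (\<Union>i<n. A i) = {}"
      by blast
    then have "pv (A n) + pv (\<Union>i<n. A i) \<le> pv (A n \<union> (\<Union>i<n. A i))"
      using meas by (intro pv_Un_ge sets.finite_UN) auto
    also have "A n \<union> (\<Union>i<n. A i) = (\<Union>i<Suc n. A i)"
      by (auto simp: less_Suc_eq)
    finally have "pv (\<Union>i<n. A i) + pv (A n) \<le> pv (\<Union>i<Suc n. A i)"
      by (simp add: add.commute)
    moreover have "(\<Sum>i<Suc n. pv (A i)) \<le> pv (\<Union>i<n. A i) + pv (A n)"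
      using Suc by (simp add: add_right_mono)
    ultimately show ?case
      by (rule order_trans[rotated])
  qed simp
  moreover have "pv (\<Union>i<n. A i) \<le> pv (\<Union>i. A i)" for n
    by (rule pv_mono) auto
  ultimately have "(\<Sum>i<n. pv (A i)) \<le> pv (\<Union>i. A i)" for n
    by (rule order_trans)
  then show "(\<Sum>i. pv (A i)) \<le> pv (\<Union>i. A i)"
    by (intro suminf_le_const) auto
  show "pv (\<Union>i. A i) \<le> (\<Sum>i. pv (A i))"
  proof (rule pv_least)
    fix B assume "B \<in> sets borel" "B \<subseteq> (\<Union>i. A i)"
    then have B: "B \<in> sets borel" "(\<Union>i. B \<inter> A i) = B"
      by auto
    have "(\<lambda>i. \<nu> (B \<inter> A i)) sums \<nu> (\<Union>i. B \<inter> A i)"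
      using B meas disjoint_family_on_bisimulation[OF A(2), of "\<lambda>i. B \<inter> A i"]
      by (intro sums_disjoint) blast+
    then have "(\<lambda>n. \<Sum>i<n. \<nu> (B \<inter> A i)) \<longlonglongrightarrow> \<nu> B"
      using B by (simp add: sums_def)
    then have "(\<lambda>n. ennreal (\<Sum>i<n. \<nu> (B \<inter> A i))) \<longlonglongrightarrow> ennreal (\<nu> B)"
      by (rule tendsto_ennrealI)
    moreover have "ennreal (\<Sum>i<n. \<nu> (B \<inter> A i)) \<le> (\<Sum>i. pv (A i))" for n
    proof -
      \<comment> \<open>Some pieces may have negative value, so each term is replaced by its
        positive part before \<open>ennreal\<close> is moved inside the sum.\<close>
      have "ennreal (\<Sum>i<n. \<nu> (B \<inter> A i)) \<le> ennreal (\<Sum>i<n. max 0 (\<nu> (B \<inter> A i)))"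
        by (intro ennreal_leI sum_mono) auto
      also have "\<dots> = (\<Sum>i<n. ennreal (\<nu> (B \<inter> A i)))"
        by (simp add: ennreal_max_0 flip: sum_ennreal)
      also have "\<dots> \<le> (\<Sum>i<n. pv (A i))"
        using B meas by (intro sum_mono pv_upper) auto
      also have "\<dots> \<le> (\<Sum>i. pv (A i))"
        by (intro sum_le_suminf) auto
      finally show ?thesis .
    qed
    ultimately show "ennreal (\<nu> B) \<le> (\<Sum>i. pv (A i))"
      by (intro LIMSEQ_le_const2) auto
  qed
qed

lemma sets_positive_variation [simp, measurable_cong]: "sets (positive_variation \<nu>) = sets borel"
  using sigma_algebra.sets_measure_of_eq[OF sets.sigma_algebra_axioms[of borel]]
  unfolding positive_variation_def by simp

lemma space_positive_variation [simp]: "space (positive_variation \<nu>) = UNIV"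
  using sets_eq_imp_space_eq[OF sets_positive_variation] by simp

text \<open>\<open>measure_of\<close> takes over the values of a set function once that function is
  known to be positive and countably additive, which is the purpose of \<open>pv_UN\<close>.\<close>

lemma emeasure_positive_variation:
  assumes "A \<in> sets borel"
  shows "emeasure (positive_variation \<nu>) A = pv A"
  unfolding positive_variation_def pv_def[symmetric]
proof (rule emeasure_measure_of_sigma)
  show "sigma_algebra UNIV (sets borel)"
    using sets.sigma_algebra_axioms[of borel] by simp
  show "positive (sets borel) pv"
    by (auto simp: positive_def intro!: antisym pv_least)
  show "countably_additive (sets borel) pv"
    unfolding countably_additive_def using pv_UN by blast
qed fact

sublocale pos: finite_measure "positive_variation \<nu>"
proof
  obtain c where c: "\<And>B. B \<in> sets borel \<Longrightarrow> \<bar>\<nu> B\<bar> \<le> c"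
    using bounded_on_UNIV unfolding bounded_on_def by blast
  have "pv UNIV \<le> ennreal c"
    using c by (intro pv_least ennreal_leI) force
  then show "emeasure (positive_variation \<nu>) (space (positive_variation \<nu>)) \<noteq> \<infinity>"
    by (auto simp: emeasure_positive_variation top_unique)
qed

lemma measure_pv_upper:
  assumes "A \<in> sets borel" "B \<in> sets borel" "B \<subseteq> A"
  shows "\<nu> B \<le> measure (positive_variation \<nu>) A"
proof -
  have "ennreal (\<nu> B) \<le> ennreal (measure (positive_variation \<nu>) A)"
    using pv_upper[OF assms(2,3)]
    by (simp only: pos.emeasure_eq_measure[symmetric] emeasure_positive_variation[OF assms(1)])
  then show ?thesis
    by (simp add: ennreal_le_iff)
qed

lemma measure_pv_least:
  assumes "A \<in> sets borel" "\<And>B. B \<in> sets borel \<Longrightarrow> B \<subseteq> A \<Longrightarrow> \<nu> B \<le> c"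
  shows "measure (positive_variation \<nu>) A \<le> c"
proof -
  have "0 \<le> c"
    using assms(2)[of "{}"] by simp
  have "pv A \<le> ennreal c"
    using assms by (intro pv_least ennreal_leI) auto
  then have "ennreal (measure (positive_variation \<nu>) A) \<le> ennreal c"
    by (simp only: pos.emeasure_eq_measure[symmetric] emeasure_positive_variation[OF assms(1)])
  then show ?thesis
    using \<open>0 \<le> c\<close> by (simp add: ennreal_le_iff)
qed

text \<open>No Hahn set is used: for \<open>B\<close> inside \<open>A\<close>,
  \<open>\<nu> B = \<nu> A - \<nu> (A - B)\<close>, and bounding the last term by the opposite
  variation of \<open>A\<close> gives one inequality for each sign.\<close>

lemma jordan_decomposition:
  assumes A: "A \<in> sets borel"
  shows "\<nu> A = measure (positive_variation \<nu>) A - measure (positive_variation (\<lambda>A. - \<nu> A)) A"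
proof -
  interpret neg: signed_borel_measure "\<lambda>A. - \<nu> A"
    by (rule uminus)
  let ?p = "measure (positive_variation \<nu>) A" and ?n = "measure (positive_variation (\<lambda>A. - \<nu> A)) A"
  have "?p \<le> \<nu> A + ?n"
  proof (rule measure_pv_least[OF A])
    fix B :: "'a set" assume B: "B \<in> sets borel" "B \<subseteq> A"
    then show "\<nu> B \<le> \<nu> A + ?n"
      using neg.measure_pv_upper[OF A, of "A - B"] Diff[OF A B] A by auto
  qed
  moreover have "?n \<le> ?p - \<nu> A"
  proof (rule neg.measure_pv_least[OF A])
    fix B :: "'a set" assume B: "B \<in> sets borel" "B \<subseteq> A"
    then show "- \<nu> B \<le> ?p - \<nu> A"
      using measure_pv_upper[OF A, of "A - B"] Diff[OF A B] A by auto
  qed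
  ultimately show ?thesis
    by simp
qed

text \<open>All Borel subsets of the complement of \<open>S\<close> have value 0, so the supremum
  defining the variation of the complement is 0.\<close>

lemma AE_positive_variation:
  assumes "S \<in> sets borel" "\<And>A. A \<in> sets borel \<Longrightarrow> A \<inter> S = {} \<Longrightarrow> \<nu> A = 0"
  shows "AE x in positive_variation \<nu>. x \<in> S"
proof (rule AE_I')
  have "pv (- S) = 0"
    using assms by (intro antisym pv_least) (auto simp: disjoint_eq_subset_Compl)
  moreover have "- S \<in> sets borel"
    using assms by auto
  ultimately show "- S \<in> null_sets (positive_variation \<nu>)"
    by (auto simp: null_sets_def emeasure_positive_variation)
qed auto

end

section \<open>Moments\<close>

locale unit_ball_measure = finite_measure M for M :: "'a::euclidean_space measure" +
  assumes sets_eq [simp, measurable_cong]: "sets M = sets borel"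
    and AE_ball: "AE x in M. x \<in> cball 0 1"
begin

lemma space_eq [simp]: "space M = UNIV"
  using sets_eq_imp_space_eq[OF sets_eq] by simp

lemma integrable_continuous:
  fixes f :: "'a \<Rightarrow> 'b::{banach,second_countable_topology}"
  assumes "continuous_on UNIV f"
  shows "integrable M f"
proof -
  have "compact (f ` cball 0 1)"
    using assms by (intro compact_continuous_image) (auto intro: continuous_on_subset)
  then obtain B where B: "\<And>x. x \<in> cball 0 1 \<Longrightarrow> norm (f x) \<le> B"
    by (meson bounded_iff compact_imp_bounded imageI)
  have "f \<in> borel_measurable borel"
    using assms by (rule borel_measurable_continuous_onI)
  then show ?thesis
    using AE_ball B by (intro integrable_const_bound[of _ B]) (auto elim!: eventually_mono)
qed

lemma norm_inner_power_le:
  assumes "x \<in> cball 0 1"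
  shows "\<bar>x \<bullet> w\<bar> ^ n \<le> norm w ^ n"
proof -
  have "\<bar>x \<bullet> w\<bar> \<le> norm x * norm w"
    by (rule Cauchy_Schwarz_ineq2)
  also have "\<dots> \<le> 1 * norm w"
    using assms by (intro mult_right_mono) auto
  finally show ?thesis
    by (intro power_mono) auto
qed

text \<open>Termwise integration of the exponential series: on the unit ball Cauchy-Schwarz bounds
  the terms by those of the series of \<open>exp (norm c * norm w)\<close>, and the total mass is
  finite.\<close>

lemma sums_integral_exp_inner:
  fixes c :: complex
  shows "(\<lambda>n. c ^ n / fact n * of_real (\<integral>x. (x \<bullet> w) ^ n \<partial>M)) sums (\<integral>x. exp (c * of_real (x \<bullet> w)) \<partial>M)"
proof -
  let ?f = "\<lambda>n x. c ^ n / fact n * of_real ((x \<bullet> w) ^ n)"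
  have int: "integrable M (?f n)" for n
    by (rule integrable_continuous) (intro continuous_intros)
  have exp: "?f n x = (c * of_real (x \<bullet> w)) ^ n /\<^sub>R fact n" for n x
    by (simp add: power_mult_distrib scaleR_conv_of_real field_simps)
  have "(\<lambda>n. integral\<^sup>L M (?f n)) sums (\<integral>x. (\<Sum>n. ?f n x) \<partial>M)"
  proof (rule sums_integral[OF int])
    show "AE x in M. summable (\<lambda>n. norm (?f n x))"
      unfolding exp by (intro AE_I2 summable_norm_exp)
    let ?g = "\<lambda>n. (norm c * norm w) ^ n /\<^sub>R fact n * measure M UNIV"
    show "summable (\<lambda>n. \<integral>x. norm (?f n x) \<partial>M)"
    proof (rule summable_comparison_test')
      show "summable ?g"
        by (intro summable_mult2 summable_exp_generic)
      show "norm (\<integral>x. norm (?f n x) \<partial>M) \<le> ?g n" if "n \<ge> 0" for n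
      proof -
        have "(\<integral>x. norm (?f n x) \<partial>M) \<le> (\<integral>x. (norm c * norm w) ^ n /\<^sub>R fact n \<partial>M)"
        proof (rule integral_mono_AE)
          show "AE x in M. norm (?f n x) \<le> (norm c * norm w) ^ n /\<^sub>R fact n"
            using AE_ball
          proof eventually_elim
            case (elim x)
            have "norm (?f n x) = norm c ^ n / fact n * \<bar>x \<bullet> w\<bar> ^ n"
              by (simp add: norm_mult norm_divide norm_power)
            also have "\<dots> \<le> norm c ^ n / fact n * norm w ^ n"
              using elim by (intro mult_left_mono norm_inner_power_le) auto
            finally show ?case
              by (simp add: power_mult_distrib field_simps)
          qed
        qed (use int in auto)
        then show ?thesis
          by (simp add: mult_ac)
      qed
    qed
  qed
  moreover have "(\<Sum>n. ?f n x) = exp (c * of_real (x \<bullet> w))" for x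
    unfolding exp by (simp add: exp_def)
  moreover have "integral\<^sup>L M (?f n) = c ^ n / fact n * of_real (\<integral>x. (x \<bullet> w) ^ n \<partial>M)" for n
    by (subst integral_complex_of_real[symmetric]) (simp del: of_real_power integral_complex_of_real)
  ultimately show ?thesis
    by (simp only:)
qed

end

lemma unit_ball_measure_positive_variation:
  fixes \<nu> :: "'a::euclidean_space set \<Rightarrow> real"
  assumes "signed_borel_measure \<nu>"
    and supp: "\<And>A. A \<in> sets borel \<Longrightarrow> A \<inter> cball 0 1 = {} \<Longrightarrow> \<nu> A = 0"
  shows "unit_ball_measure (positive_variation \<nu>)"
proof -
  interpret signed_borel_measure \<nu>
    by fact
  have "(cball 0 1 :: 'a set) \<in> sets borel"
    by simp
  from AE_positive_variation[OF this supp] show ?thesis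
    by (intro unit_ball_measure.intro unit_ball_measure_axioms.intro pos.finite_measure_axioms
        sets_positive_variation) simp_all
qed

section \<open>Moments determine a measure on the unit ball\<close>

locale unit_ball_measure_pair =
  M: unit_ball_measure M + N: unit_ball_measure N for M N :: "'a::euclidean_space measure"
begin

text \<open>Functions annihilated, together with all products by \<open>\<lambda>x. (x \<bullet> v) ^ n\<close>, by \<open>M - N\<close>.\<close>

definition annihilated :: "('a \<Rightarrow> real) set" where
  "annihilated = {h. continuous_on UNIV h \<and>
     (\<forall>v n. (\<integral>x. h x * (x \<bullet> v) ^ n \<partial>M) = (\<integral>x. h x * (x \<bullet> v) ^ n \<partial>N))}"

lemma annihilated_add:
  assumes "g \<in> annihilated" "h \<in> annihilated"
  shows "(\<lambda>x. g x + h x) \<in> annihilated"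
proof -
  have "integrable M (\<lambda>x. f x * (x \<bullet> v) ^ n)" "integrable N (\<lambda>x. f x * (x \<bullet> v) ^ n)"
    if "f \<in> annihilated" for f v n
    using that unfolding annihilated_def
    by (auto intro!: M.integrable_continuous N.integrable_continuous continuous_intros)
  then show ?thesis
    using assms by (auto simp: annihilated_def distrib_right intro!: continuous_intros)
qed

text \<open>Polarization: compare the coefficients of \<open>t\<close> in the integrals of \<open>h x * (x \<bullet> (v + t u)) ^ Suc n\<close>.\<close>

lemma annihilated_mult_inner:
  assumes h: "h \<in> annihilated"
  shows "(\<lambda>x. (x \<bullet> u) * h x) \<in> annihilated"
proof -
  have cont: "continuous_on UNIV h"
    using h by (simp add: annihilated_def)
  have "(\<integral>x. (x \<bullet> u) * h x * (x \<bullet> v) ^ n \<partial>M) = (\<integral>x. (x \<bullet> u) * h x * (x \<bullet> v) ^ n \<partial>N)" for v n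
  proof -
    define g where "g k x = h x * (x \<bullet> u) ^ k * (x \<bullet> v) ^ (Suc n - k)" for k x
    \<comment> \<open>\<open>c k\<close> is the coefficient of \<open>t ^ k\<close> in the
      difference of the two integrals. With exponent \<open>Suc n\<close>, the linear coefficient
      contains exactly \<open>(x \<bullet> u) * (x \<bullet> v) ^ n\<close>.\<close>
    define c where "c k = real (Suc n choose k) * ((\<integral>x. g k x \<partial>M) - (\<integral>x. g k x \<partial>N))" for k
    have gi: "integrable M (g k)" "integrable N (g k)" for k
      unfolding g_def using cont
      by (auto intro!: M.integrable_continuous N.integrable_continuous continuous_intros)
    have "(\<Sum>k\<le>Suc n. c k * t ^ k) = 0" for t
    proof -
      have expand: "h x * (x \<bullet> (v + t *\<^sub>R u)) ^ Suc n = (\<Sum>k\<le>Suc n. real (Suc n choose k) * t ^ k * g k x)" for x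
      proof -
        have "(x \<bullet> (v + t *\<^sub>R u)) ^ Suc n = (t * (x \<bullet> u) + x \<bullet> v) ^ Suc n"
          by (simp add: inner_add_right add.commute)
        also have "\<dots> = (\<Sum>k\<le>Suc n. real (Suc n choose k) * (t * (x \<bullet> u)) ^ k * (x \<bullet> v) ^ (Suc n - k))"
          by (rule binomial_ring)
        finally show ?thesis
          by (simp only: sum_distrib_left) (auto simp: g_def power_mult_distrib intro!: sum.cong)
      qed
      have "(\<integral>x. h x * (x \<bullet> (v + t *\<^sub>R u)) ^ Suc n \<partial>M) = (\<integral>x. h x * (x \<bullet> (v + t *\<^sub>R u)) ^ Suc n \<partial>N)"
        using h by (simp only: annihilated_def) blast
      then have "(\<Sum>k\<le>Suc n. real (Suc n choose k) * t ^ k * (\<integral>x. g k x \<partial>M)) =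
          (\<Sum>k\<le>Suc n. real (Suc n choose k) * t ^ k * (\<integral>x. g k x \<partial>N))"
        unfolding expand using gi
        by (simp only: Bochner_Integration.integral_sum integrable_mult_right integral_mult_right_zero)
      then show ?thesis
        unfolding c_def by (simp only: right_diff_distrib left_diff_distrib sum_subtractf mult_ac)
    qed
    \<comment> \<open>A polynomial that vanishes at every real \<open>t\<close> has only zero
      coefficients; the factor \<open>Suc n choose 1\<close> is nonzero and cancels.\<close>
    then have "c 1 = 0"
      using polyfun_eq_0[of c "Suc n"] by auto
    then show ?thesis
      by (simp add: c_def g_def mult_ac)
  qed
  then show ?thesis
    using cont by (auto simp: annihilated_def intro!: continuous_intros)
qed

text \<open>The induction keeps \<open>h\<close> arbitrary: for a product \<open>f * g\<close> the
  hypothesis for \<open>f\<close> is applied to \<open>g * h\<close> in place of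
  \<open>h\<close>.\<close>

lemma annihilated_mult_polynomial:
  assumes "real_polynomial_function p" "h \<in> annihilated"
  shows "(\<lambda>x. p x * h x) \<in> annihilated"
  using assms
proof (induction arbitrary: h)
  case (linear f)
  \<comment> \<open>The Riesz vector of the linear functional \<open>f\<close>.\<close>
  define u where "u = (\<Sum>b\<in>Basis. f b *\<^sub>R b)"
  have "f = (\<lambda>x. x \<bullet> u)"
  proof
    fix x
    have "f x = f (\<Sum>b\<in>Basis. (x \<bullet> b) *\<^sub>R b)"
      by (simp add: euclidean_representation)
    also have "\<dots> = (\<Sum>b\<in>Basis. (x \<bullet> b) * f b)"
      using linear(1)[THEN bounded_linear.linear] by (simp add: linear_sum linear_scale)
    finally show "f x = x \<bullet> u"
      by (simp add: u_def inner_sum_right mult.commute)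
  qed
  then show ?case
    using annihilated_mult_inner[OF linear(2), of u] by simp
next
  case (const c)
  then show ?case
    by (auto simp: annihilated_def mult.assoc intro!: continuous_intros)
next
  case (add f g)
  then show ?case
    using annihilated_add[of "\<lambda>x. f x * h x" "\<lambda>x. g x * h x"] by (simp add: distrib_right)
next
  case (mult f g)
  then show ?case
    using mult.IH(1)[OF mult.IH(2)[OF mult.prems]] by (simp add: mult.assoc)
qed

text \<open>A polynomial within \<open>e\<close> of \<open>f\<close> on the ball has equal integrals
  against both measures, so the integrals of \<open>f\<close> differ by at most \<open>e\<close>
  times the sum of the two total masses.\<close>

lemma integral_eq_of_moments:
  fixes f :: "'a \<Rightarrow> real"
  assumes mom: "\<And>v n. (\<integral>x. (x \<bullet> v) ^ n \<partial>M) = (\<integral>x. (x \<bullet> v) ^ n \<partial>N)"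
    and f: "continuous_on UNIV f"
  shows "(\<integral>x. f x \<partial>M) = (\<integral>x. f x \<partial>N)"
proof -
  have "\<bar>(\<integral>x. f x \<partial>M) - (\<integral>x. f x \<partial>N)\<bar> \<le> e * (measure M UNIV + measure N UNIV)" if e: "e > 0" for e
  proof -
    have "continuous_on (cball 0 1) f"
      using f by (rule continuous_on_subset) simp
    then obtain p where p: "real_polynomial_function p" "\<And>x. x \<in> cball 0 1 \<Longrightarrow> \<bar>f x - p x\<bar> < e"
      using Stone_Weierstrass_real_polynomial_function[of "cball 0 1" f e] e by auto
    have pc: "continuous_on UNIV p"
      using continuous_real_polymonial_function[OF p(1)] by (simp add: continuous_at_imp_continuous_on)
    have "(\<lambda>x. 1) \<in> annihilated"
      using mom by (simp add: annihilated_def)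
    then have "(\<lambda>x. p x * 1) \<in> annihilated"
      by (rule annihilated_mult_polynomial[OF p(1)])
    then have "\<forall>v n. (\<integral>x. p x * 1 * (x \<bullet> v) ^ n \<partial>M) = (\<integral>x. p x * 1 * (x \<bullet> v) ^ n \<partial>N)"
      unfolding annihilated_def by blast
    \<comment> \<open>Exponent 0 turns the extra factor into 1, since
      \<open>0 ^ 0 = 1\<close>.\<close>
    from this[rule_format, of 0 0] have peq: "(\<integral>x. p x \<partial>M) = (\<integral>x. p x \<partial>N)"
      by simp
    have bound: "\<bar>(\<integral>x. f x \<partial>L) - (\<integral>x. p x \<partial>L)\<bar> \<le> e * measure L UNIV"
      if "unit_ball_measure L" for L
    proof -
      interpret L: unit_ball_measure L by fact
      have i: "integrable L f" "integrable L p"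
        by (intro L.integrable_continuous f pc)+
      have "\<bar>(\<integral>x. f x \<partial>L) - (\<integral>x. p x \<partial>L)\<bar> = \<bar>\<integral>x. f x - p x \<partial>L\<bar>"
        using i by simp
      also have "\<dots> \<le> (\<integral>x. \<bar>f x - p x\<bar> \<partial>L)"
        by (rule integral_abs_bound)
      also have "\<dots> \<le> (\<integral>x. e \<partial>L)"
        using i L.AE_ball p(2)
        by (intro integral_mono_AE) (auto elim!: eventually_mono intro: less_imp_le)
      finally show ?thesis
        by (simp add: mult.commute)
    qed
    show ?thesis
      using bound[OF M.unit_ball_measure_axioms] bound[OF N.unit_ball_measure_axioms] peq
      by (simp add: distrib_left)
  qed
  moreover define K where "K = measure M UNIV + measure N UNIV"
  ultimately have *: "\<bar>(\<integral>x. f x \<partial>M) - (\<integral>x. f x \<partial>N)\<bar> \<le> e * K" if "e > 0" for e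
    using that by simp
  have "K \<ge> 0"
    by (simp add: K_def)
  have "\<bar>(\<integral>x. f x \<partial>M) - (\<integral>x. f x \<partial>N)\<bar> \<le> 0"
  proof (rule field_le_epsilon)
    fix d :: real assume "d > 0"
    \<comment> \<open>Dividing by \<open>K + 1\<close> also covers the case that both measures are
      zero.\<close>
    have "d / (K + 1) * K \<le> d"
      using \<open>d > 0\<close> \<open>K \<ge> 0\<close> by (simp add: field_simps)
    then show "\<bar>(\<integral>x. f x \<partial>M) - (\<integral>x. f x \<partial>N)\<bar> \<le> 0 + d"
      using *[of "d / (K + 1)"] \<open>d > 0\<close> \<open>K \<ge> 0\<close> by auto
  qed
  then show ?thesis
    by simp
qed

text \<open>Closed sets form an intersection-stable generator of the Borel sets, and the indicator
  of a nonempty closed set is a pointwise limit of continuous functions bounded by 1, so dominated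
  convergence transfers equality of integrals to equality of measures.\<close>

theorem eq_of_moments:
  assumes mom: "\<And>v n. (\<integral>x. (x \<bullet> v) ^ n \<partial>M) = (\<integral>x. (x \<bullet> v) ^ n \<partial>N)"
  shows "M = N"
proof (rule measure_eqI_generator_eq)
  show "Int_stable (Collect closed :: 'a set set)"
    by (auto simp: Int_stable_def)
  have "sets borel = sigma_sets UNIV (Collect closed :: 'a set set)"
    by (simp add: borel_eq_closed)
  then show "sets M = sigma_sets UNIV (Collect closed)" "sets N = sigma_sets UNIV (Collect closed)"
    by simp_all
  show "range (\<lambda>_::nat. UNIV :: 'a set) \<subseteq> Collect closed"
    by auto
  show "emeasure M X = emeasure N X" if "X \<in> Collect closed" for X
  \<comment> \<open>By convention \<open>infdist x {} = 0\<close>, so the functions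
    \<open>f n\<close> below would not approximate the indicator of the empty set.\<close>
  proof (cases "X = {}")
    case False
    have X: "closed X" "X \<in> sets borel"
      using that by auto
    define f where "f n x = inverse (1 + infdist x X) ^ n" for n x
    have fc: "continuous_on UNIV (f n)" for n
      unfolding f_def
      by (intro continuous_intros) (metis add_strict_increasing infdist_nonneg less_irrefl zero_less_one)
    have f01: "norm (f n x) \<le> 1" for n x
    proof -
      have "inverse (1 + infdist x X) \<le> 1"
        using infdist_nonneg[of x X] by (simp add: field_simps)
      then show ?thesis
        unfolding f_def using infdist_nonneg[of x X] by (simp add: power_le_one)
    qed
    have flim: "(\<lambda>n. f n x) \<longlonglongrightarrow> indicator X x" for x
    proof (cases "x \<in> X")
      case True
      then show ?thesis
        by (simp add: f_def)
    next
      case out: False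
      then have "infdist x X > 0"
        using X(1) False by (simp add: infdist_pos_not_in_closed)
      then have "(\<lambda>n. f n x) \<longlonglongrightarrow> 0"
        unfolding f_def by (intro LIMSEQ_power_zero) (simp add: field_simps)
      then show ?thesis
        using out by simp
    qed
    have lim: "(\<lambda>n. \<integral>x. f n x \<partial>L) \<longlonglongrightarrow> measure L X" if "unit_ball_measure L" for L
    proof -
      interpret L: unit_ball_measure L by fact
      have "(\<lambda>n. \<integral>x. f n x \<partial>L) \<longlonglongrightarrow> (\<integral>x. indicator X x \<partial>L)"
        using flim f01 X fc
        by (intro integral_dominated_convergence[where w = "\<lambda>_. 1"])
           (auto intro!: borel_measurable_continuous_onI simp: measurable_cong_sets[OF L.sets_eq])
      then show ?thesis
        by simp
    qed
    have "(\<lambda>n. \<integral>x. f n x \<partial>M) \<longlonglongrightarrow> measure N X"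
      using lim[OF N.unit_ball_measure_axioms] by (simp add: integral_eq_of_moments[OF mom fc])
    then have "measure M X = measure N X"
      using lim[OF M.unit_ball_measure_axioms] LIMSEQ_unique by blast
    then show ?thesis
      by (simp add: M.emeasure_eq_measure N.emeasure_eq_measure)
  qed simp
qed auto

end

section \<open>The spirals\<close>

text \<open>Zeros of a nonzero power series are isolated, whereas the \<open>z k\<close> accumulate
  at 0.\<close>

lemma powser_eq_0_of_zeros:
  fixes a :: "nat \<Rightarrow> complex"
  assumes sm: "\<And>z. (\<lambda>n. a n * z ^ n) sums f z"
    and lim: "z \<longlonglongrightarrow> 0" and z: "\<And>k. z k \<noteq> 0" "\<And>k. f (z k) = 0"
  shows "a n = 0"
proof (rule ccontr)
  assume an: "a n \<noteq> 0"
  \<comment> \<open>The shift multiplies \<open>f\<close> by \<open>w\<close>: the new function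
    vanishes at 0 and its nonzero coefficient has positive index \<open>Suc n\<close>, so
    \<open>n = 0\<close> is no special case.\<close>
  define b where "b n = (if n = 0 then 0 else a (n - 1))" for n
  have b: "(\<lambda>n. b n * (w - 0) ^ n) sums (w * f w)" for w
  proof -
    have "(\<lambda>n. b (Suc n) * w ^ Suc n) sums (w * f w)"
      using sums_mult[OF sm, of w w] by (simp add: b_def mult_ac)
    then show ?thesis
      using sums_Suc_iff[of "\<lambda>n. b n * w ^ n"] by (simp add: b_def)
  qed
  obtain s where s: "0 < s" "\<And>w. w \<in> cball 0 s - {0} \<Longrightarrow> w * f w \<noteq> 0"
    using powser_0_nonzero[of 1 0 b "\<lambda>w. w * f w" "Suc n"] b an by (auto simp: b_def)
  obtain k where "norm (z k - 0) < s"
    using LIMSEQ_D[OF lim s(1)] by blast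
  then show False
    using s(2)[of "z k"] z[of k] by auto
qed

text \<open>The spiral meets each ray from the origin at radii in geometric progression with limit
  0. By homogeneity the series restricted to a ray is a power series in the radius, and homogeneity
  also carries the vanishing from unit vectors to all vectors.\<close>

lemma moments_eq_0_of_spiral:
  fixes d :: "nat \<Rightarrow> real \<times> real \<Rightarrow> complex" and c :: complex
  assumes c: "c \<noteq> 0"
    and hom: "\<And>n r v. d n (r *\<^sub>R v) = of_real r ^ n * d n v"
    and sm: "\<And>w. summable (\<lambda>n. c ^ n / fact n * d n w)"
    and zero: "\<And>s. s \<le> 0 \<Longrightarrow> (\<Sum>n. c ^ n / fact n * d n (exp s * cos s, exp s * sin s)) = 0"
  shows "d n v = 0"
proof -
  have dir: "d n (cos \<theta>, sin \<theta>) = 0" for n \<theta>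
  proof -
    let ?v = "(cos \<theta>, sin \<theta>)"
    define a where "a n = c ^ n / fact n * d n ?v" for n
    \<comment> \<open>\<open>K\<close> full turns bring the angle \<theta> into the admissible range
      \<open>s \<le> 0\<close>.\<close>
    obtain K :: nat where K: "\<theta> / (2 * pi) \<le> real K"
      using real_arch_simple by blast
    define s where "s k = \<theta> - 2 * pi * real (k + K)" for k
    have s0: "s k \<le> 0" for k
    proof -
      have "\<theta> \<le> 2 * pi * real K"
        using K by (simp add: field_simps)
      also have "\<dots> \<le> 2 * pi * real (k + K)"
        by (intro mult_left_mono) auto
      finally show ?thesis
        by (simp add: s_def)
    qed
    have trig: "cos (s k) = cos \<theta>" "sin (s k) = sin \<theta>" for k
    proof -
      have "s k = \<theta> + 2 * of_int (- int (k + K)) * pi"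
        by (simp add: s_def algebra_simps)
      then show "cos (s k) = cos \<theta>" "sin (s k) = sin \<theta>"
        using cos.plus_of_int[of \<theta> "- int (k + K)"] sin.plus_of_int[of \<theta> "- int (k + K)"]
        by (simp_all add: mult_ac)
    qed
    have ar: "c ^ n / fact n * d n (r *\<^sub>R ?v) = a n * of_real r ^ n" for n r
      unfolding a_def hom by simp
    \<comment> \<open>Summability is known at real radii only; convergence at the radius
      \<open>norm z + 1\<close> yields it at every complex \<open>z\<close>.\<close>
    have smz: "summable (\<lambda>n. a n * z ^ n)" for z
    proof (rule powser_inside)
      show "summable (\<lambda>n. a n * of_real (norm z + 1) ^ n)"
        using sm[of "(norm z + 1) *\<^sub>R ?v"] by (simp only: ar)
      show "norm z < norm (of_real (norm z + 1) :: complex)"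
        by (simp del: of_real_add)
    qed
    have "a n = 0"
    proof (rule powser_eq_0_of_zeros)
      show "(\<lambda>n. a n * z ^ n) sums (\<Sum>n. a n * z ^ n)" for z
        using smz by (rule summable_sums)
      have "exp (s k) = exp (\<theta> - 2 * pi * real K) * exp (- (2 * pi)) ^ k" for k
        by (simp add: s_def algebra_simps flip: exp_of_nat_mult exp_add)
      moreover have "(\<lambda>k. exp (\<theta> - 2 * pi * real K) * exp (- (2 * pi)) ^ k) \<longlonglongrightarrow> 0"
        by (intro tendsto_mult_right_zero LIMSEQ_power_zero) simp
      ultimately have "(\<lambda>k. exp (s k)) \<longlonglongrightarrow> 0"
        by (simp only:)
      then show "(\<lambda>k. complex_of_real (exp (s k))) \<longlonglongrightarrow> 0"
        using tendsto_of_real by fastforce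
      show "complex_of_real (exp (s k)) \<noteq> 0" for k
        by simp
      show "(\<Sum>n. a n * complex_of_real (exp (s k)) ^ n) = 0" for k
        using zero[OF s0[of k]] ar[of _ "exp (s k)"] by (simp add: trig del: of_real_exp)
    qed
    then show ?thesis
      using c by (simp add: a_def)
  qed
  \<comment> \<open>Polar coordinates, borrowed from the complex plane; the origin is included as
    radius 0.\<close>
  obtain x y where v: "v = (x, y)"
    by (cases v)
  define z where "z = Complex x y"
  have "rcis (cmod z) (Arg z) = z"
    by (rule rcis_cmod_Arg)
  then have "v = cmod z *\<^sub>R (cos (Arg z), sin (Arg z))"
    by (auto simp: v z_def complex_eq_iff)
  then have "d n v = d n (cmod z *\<^sub>R (cos (Arg z), sin (Arg z)))"
    by (rule arg_cong)
  then show ?thesis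
    by (simp only: hom dir mult_zero_right)
qed

section \<open>The spiral as a smooth curve in the unit ball\<close>

definition spiral :: "real \<Rightarrow> real \<times> real" where
  "spiral t = (exp (- t) * cos t, exp (- t) * sin t)"

lemma norm_spiral: "norm (spiral t) = exp (- t)"
proof -
  have "(exp (- t) * cos t)\<^sup>2 + (exp (- t) * sin t)\<^sup>2 = (exp (- t))\<^sup>2"
    by (simp add: power_mult_distrib flip: distrib_left)
  then show ?thesis
    by (simp add: spiral_def norm_prod_def)
qed

text \<open>In complex notation the curve is \<open>exp ((- 1 + \<i>) * t)\<close>, so each
  derivative is a multiplication by \<open>- 1 + \<i>\<close>. Injectivity follows from the strictly
  decreasing norm \<open>exp (- t)\<close>.\<close>

lemma smooth_parametrization_spiral: "smooth_parametrization spiral {0..}"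
proof -
  define z where "z n t = (- 1 + \<i>) ^ n * exp ((- 1 + \<i>) * of_real t)" for n and t :: real
  define D where "D n t = (Re (z n t), Im (z n t))" for n t
  have "D 0 = spiral"
    by (auto simp: D_def z_def spiral_def Re_exp Im_exp)
  moreover have "(D n has_vector_derivative D (Suc n) t) (at t within {0..})" for n t
  proof -
    have "(z n has_vector_derivative z (Suc n) t) (at t within {0..})"
      unfolding z_def
      by (rule has_vector_derivative_real_field[THEN has_vector_derivative_at_within] |
          rule derivative_eq_intros refl | simp add: algebra_simps)+
    then show ?thesis
      unfolding D_def has_vector_derivative_complex_iff
      by (intro has_vector_derivative_Pair) (auto simp: has_real_derivative_iff_has_vector_derivative)
  qed
  moreover have "D 1 t \<noteq> 0" for t
  proof -
    have "- 1 + \<i> \<noteq> 0"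
      by (simp add: complex_eq_iff)
    then have "z 1 t \<noteq> 0"
      by (simp add: z_def)
    then show ?thesis
      by (auto simp: D_def complex_eq_iff zero_prod_def)
  qed
  moreover have "inj_on spiral {0..}"
    by (rule inj_onI) (metis norm_spiral exp_inj_iff neg_equal_iff_equal)
  moreover have "is_interval {0::real..}" "interior {0::real..} \<noteq> {}"
    by (auto simp: is_interval_ci)
  ultimately show ?thesis
    unfolding smooth_parametrization_def by blast
qed

lemma smooth_curve_image:
  assumes "smooth_parametrization \<gamma> I"
  shows "smooth_curve (\<gamma> ` I)"
  unfolding smooth_curve_def curve_arc_length_def
  using assms
  by (intro exI[of _ "arc_length_measure \<gamma> I"] exI[of _ "1::nat"] exI[of _ "\<lambda>_. \<gamma>"] exI[of _ "\<lambda>_. I"])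
     (auto simp: arc_length_measure_def disjoint_family_on_def)

text \<open>The variations of the real and imaginary parts are four finite measures on the unit
  ball. Once the complex moments vanish, the two variations of each part have equal moments and
  hence coincide, and the Jordan decomposition leaves 0.\<close>

lemma complex_measure_eq_0_of_spiral:
  fixes \<mu> :: "(real \<times> real) set \<Rightarrow> complex"
  assumes \<mu>: "complex_borel_measure \<mu>"
    and supp: "\<And>A. A \<in> sets borel \<Longrightarrow> A \<inter> cball 0 1 = {} \<Longrightarrow> \<mu> A = 0"
    and zero: "\<And>s. s \<le> 0 \<Longrightarrow> fourier_transform \<mu> (exp s * cos s, exp s * sin s) = 0"
    and A: "A \<in> sets borel"
  shows "\<mu> A = 0"
proof -
  have sums: "(\<lambda>i. \<mu> (A i)) sums \<mu> (\<Union>i. A i)"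
    if "range A \<subseteq> sets borel" "disjoint_family A" for A :: "nat \<Rightarrow> _"
    using \<mu> that unfolding complex_borel_measure_def by blast
  interpret re: signed_borel_measure "\<lambda>A. Re (\<mu> A)"
    by unfold_locales (rule sums_Re, rule sums)
  interpret im: signed_borel_measure "\<lambda>A. Im (\<mu> A)"
    by unfold_locales (rule sums_Im, rule sums)
  interpret re_neg: signed_borel_measure "\<lambda>A. - Re (\<mu> A)"
    by (rule re.uminus)
  interpret im_neg: signed_borel_measure "\<lambda>A. - Im (\<mu> A)"
    by (rule im.uminus)
  let ?P = "positive_variation (\<lambda>A. Re (\<mu> A))" and ?N = "positive_variation (\<lambda>A. - Re (\<mu> A))"
  let ?P' = "positive_variation (\<lambda>A. Im (\<mu> A))" and ?N' = "positive_variation (\<lambda>A. - Im (\<mu> A))"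
  interpret R: unit_ball_measure_pair ?P ?N
    by (intro unit_ball_measure_pair.intro unit_ball_measure_positive_variation
        re.signed_borel_measure_axioms re_neg.signed_borel_measure_axioms) (simp_all add: supp)
  interpret I: unit_ball_measure_pair ?P' ?N'
    by (intro unit_ball_measure_pair.intro unit_ball_measure_positive_variation
        im.signed_borel_measure_axioms im_neg.signed_borel_measure_axioms) (simp_all add: supp)
  define m where "m L n v = complex_of_real (\<integral>x. (x \<bullet> v) ^ n \<partial>L)" for L n and v :: "real \<times> real"
  \<comment> \<open>\<open>d n v\<close> is the integral of \<open>(x \<bullet> v) ^ n\<close>
    against \<mu>. All values of \<open>m\<close> are real, so \<open>d n v = 0\<close> separates
    into one moment identity for each part.\<close>
  define d where "d n v = (m ?P n v - m ?N n v) + \<i> * (m ?P' n v - m ?N' n v)" for n v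
  define c where "c = - \<i> * of_real pi"
  have ft: "(\<lambda>n. c ^ n / fact n * d n w) sums fourier_transform \<mu> w" for w
  proof -
    have F: "fourier_transform \<mu> w = complex_measure_integral \<mu> (\<lambda>x. exp (c * of_real (x \<bullet> w)))"
      by (cases w) (simp add: fourier_transform_def c_def case_prod_unfold inner_prod_def)
    have "(\<lambda>n. (c ^ n / fact n * m ?P n w - c ^ n / fact n * m ?N n w) +
        \<i> * (c ^ n / fact n * m ?P' n w - c ^ n / fact n * m ?N' n w)) sums fourier_transform \<mu> w"
      unfolding F complex_measure_integral_def signed_integral_def m_def
      by (intro sums_add sums_diff sums_mult R.M.sums_integral_exp_inner R.N.sums_integral_exp_inner
          I.M.sums_integral_exp_inner I.N.sums_integral_exp_inner)
    then show ?thesis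
      by (simp add: d_def algebra_simps)
  qed
  have d0: "d n v = 0" for n v
  proof (rule moments_eq_0_of_spiral)
    show "c \<noteq> 0"
      by (simp add: c_def)
    show "d n (r *\<^sub>R v) = of_real r ^ n * d n v" for n r v
      by (simp add: d_def m_def power_mult_distrib algebra_simps)
    show "summable (\<lambda>n. c ^ n / fact n * d n w)" for w
      using ft by (rule sums_summable)
    show "(\<Sum>n. c ^ n / fact n * d n (exp s * cos s, exp s * sin s)) = 0" if "s \<le> 0" for s
      using ft zero[OF that] by (metis sums_unique)
  qed
  have "?P = ?N"
  proof (rule R.eq_of_moments)
    show "(\<integral>x. (x \<bullet> v) ^ n \<partial>?P) = (\<integral>x. (x \<bullet> v) ^ n \<partial>?N)" for v n
      using arg_cong[OF d0[of n v], of Re] by (simp add: d_def m_def del: of_real_power)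
  qed
  moreover have "?P' = ?N'"
  proof (rule I.eq_of_moments)
    show "(\<integral>x. (x \<bullet> v) ^ n \<partial>?P') = (\<integral>x. (x \<bullet> v) ^ n \<partial>?N')" for v n
      using arg_cong[OF d0[of n v], of Im] by (simp add: d_def m_def del: of_real_power)
  qed
  ultimately show ?thesis
    using re.jordan_decomposition[OF A] im.jordan_decomposition[OF A] by (simp add: complex_eq_iff)
qed

theorem theorem2p1:
  "heisenberg_uniqueness_pair
     {(exp (- t) * cos t, exp (- t) * sin t) | t :: real. t \<ge> 0}
     {(exp s * cos s, exp s * sin s) | s :: real. s \<le> 0}"
proof -
  have \<Gamma>: "{(exp (- t) * cos t, exp (- t) * sin t) | t :: real. t \<ge> 0} = spiral ` {0..}"
    by (auto simp: spiral_def)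
  have ball: "spiral ` {0..} \<subseteq> cball 0 1"
    by (auto simp: norm_spiral)
  show ?thesis
    unfolding heisenberg_uniqueness_pair_def \<Gamma>
  proof (intro conjI ballI impI)
    show "smooth_curve (spiral ` {0..})"
      by (intro smooth_curve_image smooth_parametrization_spiral)
    fix \<mu> and A :: "(real \<times> real) set"
    assume \<mu>: "\<mu> \<in> curve_measures (spiral ` {0..})"
      and zero: "\<forall>\<zeta>\<in>{(exp s * cos s, exp s * sin s) | s :: real. s \<le> 0}. fourier_transform \<mu> \<zeta> = 0"
      and A: "A \<in> sets borel"
    show "\<mu> A = 0"
    proof (rule complex_measure_eq_0_of_spiral[OF _ _ _ A])
      show "complex_borel_measure \<mu>"
        using \<mu> by (simp add: curve_measures_def)
      show "\<mu> B = 0" if "B \<in> sets borel" "B \<inter> cball 0 1 = {}" for B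
      proof -
        \<comment> \<open>For \<open>t \<ge> 0\<close> the norm \<open>exp (- t)\<close> is at most
          1, so a set that misses the ball also misses the curve.\<close>
        have "B \<inter> spiral ` {0..} = {}"
          using that(2) ball by blast
        then show ?thesis
          using \<mu> that(1) by (simp add: curve_measures_def)
      qed
      show "fourier_transform \<mu> (exp s * cos s, exp s * sin s) = 0" if "s \<le> 0" for s
        using zero that by blast
    qed
  qed
qed

end
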